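(* Let $\alpha>0$ be a real algebraic number. The semidomain $\mathbb{N}_0[\alpha]$ is bi-UFS if and only if $\alpha\in\mathbb{N}$.
   Context: $\mathbb{N}$ denotes the positive integers and $\mathbb{N}_0=\mathbb{N}\cup\{0\}$. For $\alpha\in\mathbb{R}_{>0}$, $\mathbb{N}_0[\alpha]=\{f(\alpha): f(x)\in\mathbb{N}_0[x]\}$. All monoids are commutative and cancellative. A nonunit $a$ of a monoid $M$ is an atom if $a=xy$ with $x,y\in M$ forces $x$ or $y$ to be a unit. A monoid is a unique factorization monoid (UFM) if every nonunit factors into finitely many atoms, uniquely up to order and multiplication by units. A positive semidomain is a subset $S\subseteq\mathbb{R}_{\ge 0}$ containing $0$ and $1$ and closed under addition and multiplication; put $S^*=S\setminus\{0\}$. $S$ is bi-UFS if both the additive monoid $(S,+)$ and the multiplicative monoid $(S^*,\cdot)$ are UFMs. *)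

theory Defs
  imports "HOL-Algebra.Divisibility" "HOL-Computational_Algebra.Polynomial"
begin

definition positive_semidomain :: "real set \<Rightarrow> bool" where
  "positive_semidomain S \<longleftrightarrow>
     S \<subseteq> {0..} \<and> 0 \<in> S \<and> 1 \<in> S \<and>
     (\<forall>x\<in>S. \<forall>y\<in>S. x + y \<in> S) \<and> (\<forall>x\<in>S. \<forall>y\<in>S. x * y \<in> S)"

definition additive_monoid :: "real set \<Rightarrow> real monoid" where
  "additive_monoid S = \<lparr>carrier = S, mult = (+), one = 0\<rparr>"

definition multiplicative_monoid :: "real set \<Rightarrow> real monoid" where
  "multiplicative_monoid S = \<lparr>carrier = S - {0}, mult = (*), one = 1\<rparr>"

(* factorial_monoid is the library's unique factorization monoid. Its atoms are the elements
   satisfying Divisibility.irreducible, which is defined through proper divisors;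
   the lemma irreducible_iff_atom below gives the description by products. *)
definition bi_UFS :: "real set \<Rightarrow> bool" where
  "bi_UFS S \<longleftrightarrow>
     positive_semidomain S \<and>
     factorial_monoid (additive_monoid S) \<and> factorial_monoid (multiplicative_monoid S)"

definition nat_adjoin :: "real \<Rightarrow> real set" where
  "nat_adjoin \<alpha> = {poly (map_poly real f) \<alpha> | f :: nat poly. True}"

lemma (in comm_monoid_cancel) irreducible_iff_atom:
  assumes a: "a \<in> carrier G"
  shows "Divisibility.irreducible G a \<longleftrightarrow>
    a \<notin> Units G \<and>
    (\<forall>x\<in>carrier G. \<forall>y\<in>carrier G. a = x \<otimes> y \<longrightarrow> x \<in> Units G \<or> y \<in> Units G)"
    (is "_ \<longleftrightarrow> ?R")
proof
  assume irr: "Divisibility.irreducible G a"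
  show ?R
  proof (intro conjI ballI impI)
    show "a \<notin> Units G" using irr by (auto simp: Divisibility.irreducible_def)
    fix x y assume x: "x \<in> carrier G" and y: "y \<in> carrier G" and e: "a = x \<otimes> y"
    show "x \<in> Units G \<or> y \<in> Units G"
    proof (cases "a divides x")
      case True
      then obtain c where c: "c \<in> carrier G" "x = a \<otimes> c" by (auto simp: factor_def)
      have "x \<otimes> (y \<otimes> c) = x \<otimes> \<one>" using c x y e by (simp add: m_assoc)
      then have "y \<otimes> c = \<one>" using x y c by (meson l_cancel m_closed one_closed)
      then have "y \<in> Units G" using y c m_comm[of c y] by (auto simp: Units_def)
      then show ?thesis ..
    next
      case False
      then have "properfactor G x a" using x y e by (auto simp: properfactor_def factor_def)
      then show ?thesis using irr x by (auto simp: Divisibility.irreducible_def)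
    qed
  qed
next
  assume R: ?R
  show "Divisibility.irreducible G a"
    unfolding Divisibility.irreducible_def
  proof (intro conjI ballI impI)
    show "a \<notin> Units G" using R by blast
    fix b assume b: "b \<in> carrier G" and p: "properfactor G b a"
    then obtain c where c: "c \<in> carrier G" "a = b \<otimes> c"
      by (auto simp: properfactor_def factor_def)
    have "c \<notin> Units G"
    proof
      assume u: "c \<in> Units G"
      then have "b = a \<otimes> inv c" using b c by (simp add: m_assoc)
      then have "a divides b" using u by (auto simp: factor_def)
      then show False using p by (simp add: properfactor_def)
    qed
    then show "b \<in> Units G" using R b c by blast
  qed
qed

lemma map_poly_real_add: "map_poly real (f + g) = map_poly real f + map_poly real g"
  by (rule poly_eqI) (simp add: coeff_map_poly)

lemma map_poly_real_mult: "map_poly real (f * g) = map_poly real f * map_poly real g"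
  by (rule poly_eqI) (simp add: coeff_map_poly coeff_mult)

lemma positive_semidomain_nat_adjoin:
  assumes "\<alpha> > 0"
  shows "positive_semidomain (nat_adjoin \<alpha>)"
  unfolding positive_semidomain_def
proof (intro conjI ballI)
  show "nat_adjoin \<alpha> \<subseteq> {0..}"
    using assms by (auto simp: nat_adjoin_def poly_altdef coeff_map_poly intro!: sum_nonneg)
  show "0 \<in> nat_adjoin \<alpha>" by (auto simp: nat_adjoin_def intro!: exI[of _ 0])
  show "1 \<in> nat_adjoin \<alpha>" by (auto simp: nat_adjoin_def intro!: exI[of _ 1])
  fix x y assume "x \<in> nat_adjoin \<alpha>" "y \<in> nat_adjoin \<alpha>"
  then obtain f g :: "nat poly"
    where x: "x = poly (map_poly real f) \<alpha>" and y: "y = poly (map_poly real g) \<alpha>"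
    by (auto simp: nat_adjoin_def)
  have "x + y = poly (map_poly real (f + g)) \<alpha>" by (simp add: x y map_poly_real_add)
  then show "x + y \<in> nat_adjoin \<alpha>" unfolding nat_adjoin_def by blast
  have "x * y = poly (map_poly real (f * g)) \<alpha>" by (simp add: x y map_poly_real_mult)
  then show "x * y \<in> nat_adjoin \<alpha>" unfolding nat_adjoin_def by blast
qed

end

theory Submission
  imports Defs
begin

text \<open>
  Write \<open>S\<close> for \<open>\<nat>\<^sub>0[\<alpha>]\<close>. If \<open>\<alpha>\<close> is a positive integer then \<open>S\<close> is the set of natural numbers, whose additive
  monoid is free on \<open>1\<close> and whose multiplicative monoid is factorial by the fundamental theorem of
  arithmetic.

  Conversely let \<open>S\<close> be bi-UFS and \<open>\<alpha> \<noteq> 1\<close>. Every additive atom is a power of \<open>\<alpha>\<close>, and the exponents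
  that give atoms form an initial segment of the natural numbers. Distinct atoms satisfy no additive
  relation, whereas the algebraic number \<open>\<alpha>\<close> satisfies some relation \<open>f(\<alpha>) = g(\<alpha>)\<close> with distinct \<open>f\<close>
  and \<open>g\<close> over the naturals; so the segment is finite, say the exponents below \<open>n\<close>. Hence \<open>S\<close> is
  additively free on \<open>1, \<alpha>, \<dots>, \<alpha>\<^sup>n\<^sup>-\<^sup>1\<close>, and \<open>\<alpha>\<^sup>n = c(\<alpha>)\<close> for a polynomial \<open>c\<close> of degree below \<open>n\<close> with
  natural coefficients (\<open>factorial_additive_imp_power_basis\<close>). If \<open>n = 1\<close>, then \<open>\<alpha> = c\<close> is an integer.

  It remains to refute unique factorization of the multiplicative monoid when \<open>n \<ge> 2\<close>. In that case
  \<open>\<alpha> > 1\<close>, every nonzero element of \<open>S\<close> is at least \<open>1\<close>, the only unit is \<open>1\<close>, and \<open>\<alpha>\<close> is an atom; if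
  factorization were unique, atoms would be prime. Coordinates in the power basis decide
  divisibility by \<open>\<alpha>\<close>. Write \<open>c(x) = b + x d(x)\<close>, where \<open>b \<ge> 1\<close>.

  \<^item> If \<open>d \<noteq> 0\<close>, then \<open>\<alpha>\<close> is not prime (\<open>factorial_imp_pure_power\<close>). For \<open>b \<ge> 2\<close> it divides the product
    of \<open>b\<close> and \<open>1 + \<alpha> d(\<alpha>)\<close>, for \<open>b = 1\<close> it divides the square of \<open>2 + \<alpha> d(\<alpha>)\<close>, but it divides none of
    the factors.

  \<^item> If \<open>d = 0\<close>, then \<open>\<alpha>\<^sup>n = b \<ge> 2\<close>. Now \<open>1 + \<alpha>\<close> is an atom that is not prime
    (\<open>pure_power_not_factorial\<close>), by the identity
    \<open>(1 + x)(1 + x\<^sup>2 + x\<^sup>4) = (1 + x + x\<^sup>2)(1 + x\<^sup>3)\<close>, which already shows that factorization of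
    polynomials over the naturals is not unique.
\<close>

section \<open>Evaluating polynomials with natural coefficients\<close>

definition nat_eval :: "real \<Rightarrow> nat poly \<Rightarrow> real" where
  "nat_eval \<alpha> f = poly (map_poly real f) \<alpha>"

lemma nat_adjoin_eq_range: "nat_adjoin \<alpha> = range (nat_eval \<alpha>)"
  by (auto simp: nat_adjoin_def nat_eval_def)

lemma nat_eval_in_nat_adjoin [simp]: "nat_eval \<alpha> f \<in> nat_adjoin \<alpha>"
  by (simp add: nat_adjoin_eq_range)

lemma nat_eval_0 [simp]: "nat_eval \<alpha> 0 = 0"
  by (simp add: nat_eval_def)

lemma nat_eval_add: "nat_eval \<alpha> (f + g) = nat_eval \<alpha> f + nat_eval \<alpha> g"
  by (simp add: nat_eval_def map_poly_real_add)

lemma nat_eval_mult: "nat_eval \<alpha> (f * g) = nat_eval \<alpha> f * nat_eval \<alpha> g"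
  by (simp add: nat_eval_def map_poly_real_mult)

lemma nat_eval_pCons [simp]: "nat_eval \<alpha> (pCons a f) = real a + \<alpha> * nat_eval \<alpha> f"
  by (simp add: nat_eval_def map_poly_pCons)

lemma nat_eval_1 [simp]: "nat_eval \<alpha> 1 = 1"
  by (simp add: nat_eval_def)

lemma nat_eval_monom: "nat_eval \<alpha> (monom a k) = real a * \<alpha> ^ k"
  by (simp add: nat_eval_def map_poly_monom poly_monom)

lemma nat_eval_smult: "nat_eval \<alpha> (smult a f) = real a * nat_eval \<alpha> f"
proof -
  have "smult a f = [:a:] * f" by simp
  then show ?thesis by (simp only: nat_eval_mult) simp
qed

lemma nat_eval_altdef: "nat_eval \<alpha> f = (\<Sum>i\<le>degree f. real (coeff f i) * \<alpha> ^ i)"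
  by (simp add: nat_eval_def poly_altdef coeff_map_poly degree_map_poly)

lemma nat_adjoin_add: "x \<in> nat_adjoin \<alpha> \<Longrightarrow> y \<in> nat_adjoin \<alpha> \<Longrightarrow> x + y \<in> nat_adjoin \<alpha>"
  by (auto simp: nat_adjoin_eq_range image_iff) (metis nat_eval_add)

lemma nat_adjoin_mult: "x \<in> nat_adjoin \<alpha> \<Longrightarrow> y \<in> nat_adjoin \<alpha> \<Longrightarrow> x * y \<in> nat_adjoin \<alpha>"
  by (auto simp: nat_adjoin_eq_range image_iff) (metis nat_eval_mult)

lemma power_in_nat_adjoin: "\<alpha> ^ k \<in> nat_adjoin \<alpha>"
  by (metis nat_eval_in_nat_adjoin nat_eval_monom mult_1 of_nat_1)

lemma of_nat_in_nat_adjoin: "real m \<in> nat_adjoin \<alpha>"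
  using nat_eval_in_nat_adjoin[of \<alpha> "[:m:]"] by simp

lemma gen_in_nat_adjoin: "\<alpha> \<in> nat_adjoin \<alpha>"
  using power_in_nat_adjoin[of \<alpha> 1] by simp

lemma one_in_nat_adjoin: "1 \<in> nat_adjoin \<alpha>"
  using of_nat_in_nat_adjoin[of 1 \<alpha>] by simp

lemma nat_adjoin_nonneg: "\<alpha> > 0 \<Longrightarrow> x \<in> nat_adjoin \<alpha> \<Longrightarrow> 0 \<le> x"
  using positive_semidomain_nat_adjoin[of \<alpha>] by (auto simp: positive_semidomain_def)

lemma coeff_le_nat_eval:
  assumes "\<alpha> > 0"
  shows "real (coeff f i) * \<alpha> ^ i \<le> nat_eval \<alpha> f"
proof (cases "i \<le> degree f")
  case True
  then show ?thesis unfolding nat_eval_altdef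
    using assms by (intro member_le_sum) auto
next
  case False
  then show ?thesis using nat_adjoin_nonneg[OF assms, of "nat_eval \<alpha> f"]
    by (simp add: coeff_eq_0)
qed

lemma degree_less_if_support_below:
  assumes "0 < n" "\<And>i. coeff f i \<noteq> 0 \<Longrightarrow> i < n"
  shows "degree f < n"
  using assms by (metis degree_0 leading_coeff_0_iff)

section \<open>Unique factorization in monoids without nontrivial units\<close>

definition additive_atom :: "real set \<Rightarrow> real \<Rightarrow> bool" where
  "additive_atom S a \<longleftrightarrow>
     a \<in> S \<and> a \<noteq> 0 \<and> (\<forall>x\<in>S. \<forall>y\<in>S. a = x + y \<longrightarrow> x = 0 \<or> y = 0)"

lemma Units_additive_monoid:
  assumes "S \<subseteq> {0..}" "0 \<in> S"
  shows "Units (additive_monoid S) = {0}"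
proof -
  have "x + y = 0 \<longleftrightarrow> x = 0 \<and> y = 0" if "x \<in> S" "y \<in> S" for x y
    using that assms(1) by (intro add_nonneg_eq_0_iff) auto
  then show ?thesis
    using assms(2) by (auto simp: Units_def additive_monoid_def)
qed

lemma irreducible_additive_iff:
  assumes "S \<subseteq> {0..}" "0 \<in> S" "factorial_monoid (additive_monoid S)"
  shows "a \<in> S \<and> Divisibility.irreducible (additive_monoid S) a \<longleftrightarrow> additive_atom S a"
proof -
  interpret factorial_monoid "additive_monoid S" by fact
  show ?thesis
    using irreducible_iff_atom[of a] Units_additive_monoid[OF assms(1,2)]
    by (auto simp: additive_atom_def additive_monoid_def)
qed

lemma foldr_add_eq_sum_list: "foldr (+) xs 0 = sum_list xs"
  by (induction xs) auto

lemma additive_factorization_exists: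
  assumes "S \<subseteq> {0..}" "0 \<in> S" "factorial_monoid (additive_monoid S)" "a \<in> S"
  shows "\<exists>fs. (\<forall>x\<in>set fs. additive_atom S x) \<and> sum_list fs = a"
proof (cases "a = 0")
  case True
  then show ?thesis by (intro exI[of _ "[]"]) auto
next
  case False
  interpret factorial_monoid "additive_monoid S" by fact
  obtain fs where "set fs \<subseteq> S" "factors (additive_monoid S) fs a"
    using factors_exist[of a] False assms Units_additive_monoid[OF assms(1,2)]
    by (auto simp: additive_monoid_def)
  then show ?thesis
    using irreducible_additive_iff[OF assms(1-3)]
    by (intro exI[of _ fs])
      (auto simp: factors_def foldr_add_eq_sum_list additive_monoid_def)
qed

lemma additive_factorization_unique:
  assumes S: "S \<subseteq> {0..}" "0 \<in> S" "factorial_monoid (additive_monoid S)"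
    and add: "\<And>x y. x \<in> S \<Longrightarrow> y \<in> S \<Longrightarrow> x + y \<in> S"
    and fs: "\<And>x. x \<in> set fs \<Longrightarrow> additive_atom S x"
    and gs: "\<And>x. x \<in> set gs \<Longrightarrow> additive_atom S x"
    and eq: "sum_list fs = sum_list gs"
  shows "mset fs = mset gs"
proof -
  interpret factorial_monoid "additive_monoid S" by fact
  have closed: "sum_list hs \<in> S" if "\<And>x. x \<in> set hs \<Longrightarrow> additive_atom S x" for hs
  proof -
    have "\<forall>x\<in>set hs. x \<in> S" using that by (simp add: additive_atom_def)
    then show ?thesis by (induction hs) (auto simp: S add)
  qed
  have pos: "0 < x" if "additive_atom S x" for x
    using that S by (force simp: additive_atom_def)
  have nonempty: "sum_list hs > 0"
    if "\<And>x. x \<in> set hs \<Longrightarrow> additive_atom S x" "hs \<noteq> []" for hs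
  proof (cases hs)
    case (Cons x xs)
    have "0 < x" "0 \<le> sum_list xs"
      using that(1) pos by (auto simp: Cons less_imp_le intro!: sum_list_nonneg)
    then show ?thesis by (simp add: Cons)
  qed (use that in simp)
  show ?thesis
  proof (cases "sum_list fs = 0")
    case True
    have "fs = []" using nonempty[of fs, OF fs] True by (metis less_irrefl)
    moreover have "gs = []" using nonempty[of gs, OF gs] True eq by (metis less_irrefl)
    ultimately show ?thesis by simp
  next
    case False
    have fac: "factors (additive_monoid S) hs (sum_list hs)"
      if "\<And>x. x \<in> set hs \<Longrightarrow> additive_atom S x" for hs
      using that irreducible_additive_iff[OF S]
      by (auto simp: factors_def foldr_add_eq_sum_list additive_monoid_def)
    have sub: "set hs \<subseteq> carrier (additive_monoid S)"
      if "\<And>x. x \<in> set hs \<Longrightarrow> additive_atom S x" for hs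
      using that by (auto simp: additive_atom_def additive_monoid_def)
    have "essentially_equal (additive_monoid S) fs gs"
    proof (rule factors_unique)
      show "factors (additive_monoid S) fs (sum_list fs)" by (rule fac[OF fs])
      show "factors (additive_monoid S) gs (sum_list fs)" unfolding eq by (rule fac[OF gs])
      show "sum_list fs \<in> carrier (additive_monoid S)"
        using closed[OF fs] by (simp add: additive_monoid_def)
      show "sum_list fs \<notin> Units (additive_monoid S)"
        using Units_additive_monoid[OF S(1,2)] False by simp
    qed (use sub fs gs in blast)+
    then obtain hs where hs: "mset fs = mset hs"
      "list_all2 (associated (additive_monoid S)) hs gs"
      by (auto simp: essentially_equal_def)
    \<comment> \<open>Divisibility in an additive monoid of nonnegative reals implies \<open>\<le>\<close>, which is antisymmetric.\<close>
    have "x = y" if "associated (additive_monoid S) x y" for x y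
    proof -
      have "\<exists>u\<in>S. y = x + u" "\<exists>v\<in>S. x = y + v"
        using that by (simp_all add: associated_def factor_def additive_monoid_def)
      then obtain u v where "u \<in> S" "v \<in> S" "y = x + u" "x = y + v" by blast
      moreover from this have "0 \<le> u" "0 \<le> v" using S(1) by auto
      ultimately show ?thesis by linarith
    qed
    then have "associated (additive_monoid S) \<le> (=)" by blast
    then have "list_all2 (=) hs gs" using hs(2) list.rel_mono by blast
    then have "hs = gs" by (simp add: list.rel_eq)
    then show ?thesis using hs by simp
  qed
qed

text \<open>
  The bound \<open>1 \<le> x\<close> leaves \<open>1\<close> as the only unit, so that being an atom is a plain statement about
  products of reals. Admitting zero among \<open>x, y, z\<close> saves the applications from excluding it.
\<close>

lemma multiplicative_atom_prime:
  assumes fac: "factorial_monoid (multiplicative_monoid S)"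
    and ge1: "\<And>x. x \<in> S - {0} \<Longrightarrow> 1 \<le> x"
    and a: "a \<in> S" "1 < a"
    and atom: "\<And>x y. x \<in> S \<Longrightarrow> y \<in> S \<Longrightarrow> x * y = a \<Longrightarrow> x = 1 \<or> y = 1"
    and xy: "x \<in> S" "y \<in> S" "z \<in> S" "x * y = a * z"
  shows "\<exists>w\<in>S. x = a * w \<or> y = a * w"
proof (cases "x = 0 \<or> y = 0")
  case True
  have "z = 0" using True xy(4) a by auto
  then show ?thesis using True xy(3) by auto
next
  case False
  let ?M = "multiplicative_monoid S"
  interpret factorial_monoid ?M by fact
  have u: "u = 1" if "u \<in> S - {0}" "v \<in> S - {0}" "u * v = 1" for u v
  proof -
    have "1 \<le> u" "1 \<le> v" using ge1 that by auto
    moreover from this have "u * 1 \<le> u * v" by (intro mult_left_mono) auto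
    ultimately show ?thesis using that(3) by simp
  qed
  have units: "Units ?M = {1}"
  proof
    show "Units ?M \<subseteq> {1}"
    proof
      fix x assume "x \<in> Units ?M"
      then obtain y where "x \<in> S - {0}" "y \<in> S - {0}" "x * y = 1"
        by (auto simp: Units_def multiplicative_monoid_def)
      then show "x \<in> {1}" using u by blast
    qed
    show "{1} \<subseteq> Units ?M" using Units_one_closed by (simp add: multiplicative_monoid_def)
  qed
  have "\<forall>x\<in>S - {0}. \<forall>y\<in>S - {0}. a = x * y \<longrightarrow> x = 1 \<or> y = 1"
    using atom by blast
  then have "Divisibility.irreducible ?M a"
    using irreducible_iff_atom[of a] units a by (simp add: multiplicative_monoid_def)
  then have "Divisibility.prime ?M a"
    using a by (intro irreducible_prime) (auto simp: multiplicative_monoid_def)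
  moreover have "factor ?M a (x * y)"
    using xy False by (auto simp: factor_def multiplicative_monoid_def)
  ultimately show ?thesis
    using xy False prime_divides[of x y a]
    by (simp add: factor_def multiplicative_monoid_def) blast
qed

section \<open>The additive monoid\<close>

text \<open>
  An element of \<open>\<nat>\<^sub>0[\<alpha>]\<close> is a sum of powers of \<open>\<alpha>\<close>; splitting off one power that occurs in an atom
  leaves nothing else.
\<close>

lemma additive_atom_is_power:
  assumes "\<alpha> > 0" "additive_atom (nat_adjoin \<alpha>) a"
  shows "\<exists>k. a = \<alpha> ^ k"
proof -
  obtain f where f: "a = nat_eval \<alpha> f" "a \<noteq> 0"
    using assms(2) by (auto simp: additive_atom_def nat_adjoin_eq_range)
  then obtain k where k: "coeff f k \<noteq> 0" by (metis leading_coeff_0_iff nat_eval_0)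
  define g where "g = f - monom 1 k"
  have "f = monom 1 k + g"
    using k by (intro poly_eqI) (auto simp: g_def coeff_diff)
  then have "a = \<alpha> ^ k + nat_eval \<alpha> g"
    using f(1) by (metis nat_eval_add nat_eval_monom mult_1 of_nat_1)
  moreover have "\<alpha> ^ k \<noteq> 0" using assms(1) by simp
  ultimately have "nat_eval \<alpha> g = 0"
    using assms(2) power_in_nat_adjoin[of \<alpha> k] by (fastforce simp: additive_atom_def)
  then show ?thesis using \<open>a = _ + _\<close> by auto
qed

text \<open>Multiplying a splitting of \<open>\<alpha>\<^sup>j\<close> by \<open>\<alpha>\<^sup>k\<^sup>-\<^sup>j\<close> gives a splitting of \<open>\<alpha>\<^sup>k\<close>.\<close>

lemma power_atom_down_closed:
  assumes "\<alpha> > 0" "additive_atom (nat_adjoin \<alpha>) (\<alpha> ^ k)" "j \<le> k"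
  shows "additive_atom (nat_adjoin \<alpha>) (\<alpha> ^ j)"
  unfolding additive_atom_def
proof (intro conjI ballI impI)
  show "\<alpha> ^ j \<in> nat_adjoin \<alpha>" by (rule power_in_nat_adjoin)
  show "\<alpha> ^ j \<noteq> 0" using assms by simp
  fix x y assume xy: "x \<in> nat_adjoin \<alpha>" "y \<in> nat_adjoin \<alpha>" "\<alpha> ^ j = x + y"
  have "\<alpha> ^ k = \<alpha> ^ (k - j) * (x + y)"
    using assms(3) xy(3) by (metis le_add_diff_inverse2 power_add)
  also have "\<dots> = \<alpha> ^ (k - j) * x + \<alpha> ^ (k - j) * y" by (simp add: distrib_left)
  finally have "\<alpha> ^ (k - j) * x = 0 \<or> \<alpha> ^ (k - j) * y = 0"
    using assms(2) xy nat_adjoin_mult[OF power_in_nat_adjoin] unfolding additive_atom_def by blast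
  then show "x = 0 \<or> y = 0" using assms(1) by auto
qed

text \<open>
  If only atomic powers occur in \<open>f\<close>, then \<open>f\<close> records a factorization of \<open>f(\<alpha>)\<close> in the additive monoid,
  with the coefficients as multiplicities. Since \<open>\<alpha> \<noteq> 1\<close>, distinct exponents give distinct atoms, and
  the multiplicities are determined by the multiset of factors.
\<close>

lemma atomic_powers_independent:
  assumes a: "\<alpha> > 0" "\<alpha> \<noteq> 1" and fac: "factorial_monoid (additive_monoid (nat_adjoin \<alpha>))"
    and f: "\<And>i. coeff f i \<noteq> 0 \<Longrightarrow> additive_atom (nat_adjoin \<alpha>) (\<alpha> ^ i)"
    and g: "\<And>i. coeff g i \<noteq> 0 \<Longrightarrow> additive_atom (nat_adjoin \<alpha>) (\<alpha> ^ i)"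
    and eq: "nat_eval \<alpha> f = nat_eval \<alpha> g"
  shows "f = g"
proof -
  \<comment> \<open>\<open>L h\<close> lists the factors recorded by \<open>h\<close>.\<close>
  define L where
    "L h = concat (map (\<lambda>i. replicate (coeff h i) (\<alpha> ^ i)) [0..<Suc (degree h)])" for h :: "nat poly"
  have inj: "\<alpha> ^ i = \<alpha> ^ j \<longleftrightarrow> i = j" for i j
  proof (cases "\<alpha> > 1")
    case True
    then show ?thesis by (simp add: power_inject_exp)
  next
    case False
    then have "1 / \<alpha> > 1" using a by simp
    then have "(1 / \<alpha>) ^ i = (1 / \<alpha>) ^ j \<longleftrightarrow> i = j" by (rule power_inject_exp)
    then show ?thesis using a by (simp add: power_one_over)
  qed
  have sum: "sum_list (L h) = nat_eval \<alpha> h" for h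
  proof -
    have "sum_list (concat (map (\<lambda>i. replicate (coeff h i) (\<alpha> ^ i)) [0..<m]))
        = (\<Sum>i<m. real (coeff h i) * \<alpha> ^ i)" for m
      by (induction m) (auto simp: sum_list_replicate)
    then show ?thesis by (simp only: L_def nat_eval_altdef lessThan_Suc_atMost)
  qed
  have count: "count (mset (L h)) (\<alpha> ^ j) = coeff h j" for h j
  proof -
    have "count (mset (concat (map (\<lambda>i. replicate (coeff h i) (\<alpha> ^ i)) [0..<m]))) (\<alpha> ^ j)
        = (if j < m then coeff h j else 0)" for m
      by (induction m) (auto simp: inj)
    then show ?thesis unfolding L_def by (auto simp: coeff_eq_0 simp del: upt_Suc)
  qed
  have "mset (L f) = mset (L g)"
  proof (rule additive_factorization_unique[OF _ _ fac])
    show "nat_adjoin \<alpha> \<subseteq> {0..}" "0 \<in> nat_adjoin \<alpha>"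
      using positive_semidomain_nat_adjoin[OF a(1)] by (auto simp: positive_semidomain_def)
    show "additive_atom (nat_adjoin \<alpha>) x" if "x \<in> set (L f)" for x
      using that f by (auto simp: L_def simp del: upt_Suc)
    show "additive_atom (nat_adjoin \<alpha>) x" if "x \<in> set (L g)" for x
      using that g by (auto simp: L_def simp del: upt_Suc)
  qed (simp_all add: nat_adjoin_add sum eq)
  then show "f = g" using count by (metis poly_eqI)
qed

text \<open>Move the negative terms of an integer polynomial that vanishes at \<open>\<alpha>\<close> to the other side.\<close>

lemma algebraic_nat_relation:
  assumes "algebraic \<alpha>"
  obtains f g where "f \<noteq> g" "nat_eval \<alpha> f = nat_eval \<alpha> g"
proof -
  obtain p :: "int poly" where p: "p \<noteq> 0" "poly (map_poly of_int p) \<alpha> = 0"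
    using algebraicE'[OF assms] by metis
  define f where "f = map_poly nat p"
  define g where "g = map_poly (\<lambda>x. nat (- x)) p"
  have cf: "coeff f i = nat (coeff p i)" "coeff g i = nat (- coeff p i)" for i
    by (simp_all add: f_def g_def coeff_map_poly)
  have "map_poly real f = map_poly of_int p + map_poly real g"
    by (rule poly_eqI) (auto simp: coeff_map_poly cf)
  then have "nat_eval \<alpha> f = nat_eval \<alpha> g" using p by (simp add: nat_eval_def)
  moreover have "f \<noteq> g"
  proof
    assume "f = g"
    then have "nat (coeff p i) = nat (- coeff p i)" for i using cf by metis
    then have "p = 0" by (intro poly_eqI) (metis add.inverse_neutral coeff_0 nat_0_iff
          linorder_linear neg_le_0_iff_le order_antisym)
    then show False using p by simp
  qed
  ultimately show ?thesis using that by blast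
qed

text \<open>
  The outcome of additive unique factorization: the powers of \<open>\<alpha>\<close> below \<open>n\<close> freely generate the
  additive monoid, so elements have coordinates, stored as polynomials of degree below \<open>n\<close>; and \<open>c\<close>
  holds the coordinates of \<open>\<alpha>\<^sup>n\<close>, which govern multiplication by \<open>\<alpha>\<close>.
\<close>

locale power_basis =
  fixes \<alpha> :: real and n :: nat and c :: "nat poly"
  assumes pos: "\<alpha> > 0"
    and n_pos: "n > 0"
    and degree_c: "degree c < n"
    and power_n: "\<alpha> ^ n = nat_eval \<alpha> c"
    and unique: "\<And>f g. degree f < n \<Longrightarrow> degree g < n \<Longrightarrow> nat_eval \<alpha> f = nat_eval \<alpha> g \<Longrightarrow> f = g"
    and reduce: "\<And>x. x \<in> nat_adjoin \<alpha> \<Longrightarrow> \<exists>f. degree f < n \<and> nat_eval \<alpha> f = x"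

text \<open>
  Here \<open>n\<close> is the least exponent such that \<open>\<alpha>\<^sup>n\<close> is not an additive atom. It exists because the powers
  of an algebraic number are dependent, so that they cannot all be atoms.
\<close>

lemma factorial_additive_imp_power_basis:
  assumes a: "\<alpha> > 0" "\<alpha> \<noteq> 1" "algebraic \<alpha>"
    and fac: "factorial_monoid (additive_monoid (nat_adjoin \<alpha>))"
  shows "\<exists>n c. power_basis \<alpha> n c"
proof -
  define A where "A i \<longleftrightarrow> additive_atom (nat_adjoin \<alpha>) (\<alpha> ^ i)" for i
  have S: "nat_adjoin \<alpha> \<subseteq> {0..}" "0 \<in> nat_adjoin \<alpha>"
    using positive_semidomain_nat_adjoin[OF a(1)] by (auto simp: positive_semidomain_def)
  obtain f0 g0 where "f0 \<noteq> g0" "nat_eval \<alpha> f0 = nat_eval \<alpha> g0"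
    using algebraic_nat_relation[OF a(3)] .
  then obtain k where "\<not> A k"
    using atomic_powers_independent[OF a(1,2) fac, of f0 g0] by (auto simp: A_def)
  define n where "n = (LEAST k. \<not> A k)"
  have "\<not> A n" unfolding n_def using \<open>\<not> A k\<close> by (rule LeastI)
  have A_iff: "A i \<longleftrightarrow> i < n" for i
    using \<open>\<not> A n\<close> power_atom_down_closed[OF a(1), of i n] not_less_Least[of i "\<lambda>k. \<not> A k"]
      power_atom_down_closed[OF a(1), of n i]
    unfolding A_def n_def by (meson linorder_not_less)
  have supp: "\<exists>f. (\<forall>i. coeff f i \<noteq> 0 \<longrightarrow> i < n) \<and> nat_eval \<alpha> f = x"
    if x: "x \<in> nat_adjoin \<alpha>" for x
  proof -
    obtain fs where fs: "\<forall>x\<in>set fs. additive_atom (nat_adjoin \<alpha>) x" "sum_list fs = x"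
      using additive_factorization_exists[OF S fac x] by blast
    have "\<exists>f. (\<forall>i. coeff f i \<noteq> 0 \<longrightarrow> i < n) \<and> nat_eval \<alpha> f = sum_list fs"
      using fs(1)
    proof (induction fs)
      case Nil
      then show ?case by (intro exI[of _ 0]) auto
    next
      case (Cons y fs)
      then obtain f where f: "\<forall>i. coeff f i \<noteq> 0 \<longrightarrow> i < n" "nat_eval \<alpha> f = sum_list fs"
        by auto
      obtain k where k: "y = \<alpha> ^ k"
        using additive_atom_is_power[OF a(1)] Cons.prems by auto
      then have "k < n" using A_iff Cons.prems by (auto simp: A_def)
      then show ?case using f k
        by (intro exI[of _ "monom 1 k + f"]) (auto simp: nat_eval_add nat_eval_monom split: if_splits)
    qed
    then show ?thesis using fs(2) by simp
  qed
  have "n > 0"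
  proof (rule ccontr)
    assume "\<not> n > 0"
    then obtain f where "\<forall>i. coeff f i = 0" "nat_eval \<alpha> f = 1"
      using supp[OF one_in_nat_adjoin] by auto
    moreover from this have "f = 0" by (intro poly_eqI) simp
    ultimately show False by simp
  qed
  have rep: "\<exists>f. degree f < n \<and> nat_eval \<alpha> f = x" if "x \<in> nat_adjoin \<alpha>" for x
    using supp[OF that] degree_less_if_support_below[OF \<open>n > 0\<close>] by blast
  obtain c where c: "degree c < n" "nat_eval \<alpha> c = \<alpha> ^ n"
    using rep[OF power_in_nat_adjoin] by blast
  have "power_basis \<alpha> n c"
  proof
    fix f g assume fg: "degree f < n" "degree g < n" "nat_eval \<alpha> f = nat_eval \<alpha> g"
    have "coeff h i \<noteq> 0 \<Longrightarrow> A i" if "degree h < n" for h :: "nat poly" and i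
      using that A_iff le_degree[of h i] by simp
    then show "f = g" using fg atomic_powers_independent[OF a(1,2) fac] by (simp add: A_def)
  qed (use a c rep \<open>n > 0\<close> in auto)
  then show ?thesis by blast
qed

section \<open>The multiplicative monoid\<close>

text \<open>
  One factor has degree \<open>0\<close>; its value divides the leading coefficient \<open>1\<close>. The cases \<open>a = 0\<close> and
  \<open>a = 1\<close> serve to show that \<open>\<alpha>\<close> and \<open>1 + \<alpha>\<close> are atoms.
\<close>

lemma factor_of_monic_linear:
  fixes f g :: "nat poly"
  assumes "f * g = [:a, 1:]"
  shows "f = 1 \<or> g = 1"
proof -
  have "f * g \<noteq> 0" unfolding assms by simp
  then have "f \<noteq> 0" "g \<noteq> 0" by simp_all
  then have "degree f + degree g = degree [:a, 1:]" using degree_mult_eq[of f g] assms by metis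
  then have deg: "degree f + degree g = 1" by (simp only: degree_pCons_eq_if) simp
  have const: "u = 1" if u: "degree u = 0" "u * v = [:a, 1:]" for u v :: "nat poly"
  proof -
    obtain m where m: "u = [:m:]" using degree_eq_zeroE[OF u(1)] by blast
    then have "m * coeff v 1 = coeff (u * v) 1" by simp
    also have "\<dots> = 1" by (simp add: u(2))
    finally have "m = 1" by simp
    then show ?thesis using m by (simp add: one_pCons)
  qed
  show ?thesis
  proof (cases "degree f = 0")
    case True
    then show ?thesis using const assms by blast
  next
    case False
    then have "degree g = 0" using deg by simp
    then show ?thesis using const[of g f] assms by (simp add: mult.commute)
  qed
qed

locale irrational_power_basis = power_basis +
  assumes n_ge_2: "n \<ge> 2"
begin

lemma gen_times_top_power: "\<alpha> * \<alpha> ^ (n - 1) = nat_eval \<alpha> c"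
  using power_minus_mult[OF n_pos, of \<alpha>] power_n by (simp only: mult.commute)

text \<open>
  Without a constant term the relation \<open>\<alpha>\<^sup>n = c(\<alpha>)\<close> could be divided by \<open>\<alpha>\<close>, which would make \<open>\<alpha>\<^sup>n\<^sup>-\<^sup>1\<close>
  depend on the smaller powers.
\<close>

lemma const_coeff_pos: "coeff c 0 > 0"
proof (rule ccontr)
  assume "\<not> coeff c 0 > 0"
  then obtain d where d: "c = pCons 0 d" by (cases c) auto
  have "\<alpha> * \<alpha> ^ (n - 1) = \<alpha> * nat_eval \<alpha> d"
    unfolding gen_times_top_power d by simp
  then have "nat_eval \<alpha> (monom 1 (n - 1)) = nat_eval \<alpha> d"
    using pos by (simp add: nat_eval_monom)
  moreover have "degree d < n" using degree_c by (cases "d = 0") (auto simp: d)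
  ultimately have "monom 1 (n - 1) = d"
    using n_pos by (intro unique) (simp_all add: degree_monom_eq)
  then have "degree d = n - 1" "d \<noteq> 0" by (auto simp: degree_monom_eq)
  then show False using degree_c n_pos by (simp add: d)
qed

lemma gen_not_nat: "\<alpha> \<noteq> real m"
  using unique[of "[:0, 1:]" "[:m:]"] n_ge_2 by auto

lemma gen_gt_1: "\<alpha> > 1"
proof -
  have "1 \<le> real (coeff c 0) * \<alpha> ^ 0" using const_coeff_pos by simp
  also have "\<dots> \<le> \<alpha> ^ n" unfolding power_n by (rule coeff_le_nat_eval[OF pos])
  finally have "1 \<le> \<alpha> ^ n" .
  moreover have "\<alpha> ^ n < 1 ^ n" if "\<alpha> < 1"
    using that pos n_pos by (intro power_strict_mono) auto
  ultimately have "\<alpha> \<ge> 1" by fastforce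
  then show ?thesis using gen_not_nat[of 1] by simp
qed

lemma nat_eval_ge_power:
  assumes "coeff f k \<noteq> 0"
  shows "\<alpha> ^ k \<le> nat_eval \<alpha> f"
proof -
  have "1 * \<alpha> ^ k \<le> real (coeff f k) * \<alpha> ^ k"
    using assms pos by (intro mult_right_mono) auto
  then show ?thesis using coeff_le_nat_eval[OF pos, of f k] by simp
qed

lemma nonzero_ge_1:
  assumes "x \<in> nat_adjoin \<alpha> - {0}"
  shows "1 \<le> x"
proof -
  obtain f where f: "x = nat_eval \<alpha> f"
    using assms by (auto simp: nat_adjoin_eq_range)
  then have "f \<noteq> 0" using assms by auto
  then have "\<alpha> ^ degree f \<le> x" using nat_eval_ge_power[of f "degree f"] f by simp
  moreover have "1 \<le> \<alpha> ^ degree f" using gen_gt_1 by simp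
  ultimately show ?thesis by simp
qed

text \<open>
  A product of two elements is the value of a product of polynomials, and by size no power beyond
  \<open>\<alpha>\<close> occurs in it. As \<open>1 < n\<close>, coordinates turn \<open>f(\<alpha>) g(\<alpha>) = \<alpha>\<close> into a polynomial identity.
\<close>

lemma gen_is_atom:
  assumes "x \<in> nat_adjoin \<alpha>" "y \<in> nat_adjoin \<alpha>" "x * y = \<alpha>"
  shows "x = 1 \<or> y = 1"
proof -
  obtain f g where fg: "x = nat_eval \<alpha> f" "y = nat_eval \<alpha> g"
    using assms by (auto simp: nat_adjoin_eq_range)
  have ev: "nat_eval \<alpha> (f * g) = \<alpha>" using assms fg by (simp add: nat_eval_mult)
  define h where "h = f * g"
  have ev: "nat_eval \<alpha> h = \<alpha>" using ev by (simp only: h_def)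
  then have "h \<noteq> 0" using pos by auto
  then have "\<alpha> ^ degree h \<le> \<alpha> ^ 1"
    using nat_eval_ge_power[of h "degree h"] ev by simp
  then have "degree h \<le> 1" using gen_gt_1 by (simp only: power_increasing_iff)
  then have "h = [:0, 1:]"
    using ev n_ge_2 by (intro unique) auto
  then have "f = 1 \<or> g = 1" using factor_of_monic_linear[of f g 0] h_def by simp
  then show ?thesis by (auto simp: fg)
qed

text \<open>
  Multiplication by \<open>\<alpha>\<close> shifts the coordinates and replaces the overflow \<open>m \<alpha>\<^sup>n\<close> by \<open>m c(\<alpha>)\<close>. So the
  coordinates of a multiple of \<open>\<alpha>\<close> dominate those of \<open>m c\<close>, with equality in the constant term.
\<close>

lemma gen_multiple_coords:
  assumes x: "degree x < n" "nat_eval \<alpha> x = \<alpha> * z" "z \<in> nat_adjoin \<alpha>"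
  obtains m y where "x = pCons 0 y + smult m c"
proof -
  obtain f where f: "degree f < n" "nat_eval \<alpha> f = z" using reduce[OF x(3)] by blast
  define y where "y = poly_cutoff (n - 1) f"
  define m where "m = coeff f (n - 1)"
  have "f = y + monom m (n - 1)"
  proof (rule poly_eqI)
    fix i show "coeff f i = coeff (y + monom m (n - 1)) i"
      using f(1) coeff_eq_0[of f i] by (cases "i < n - 1") (auto simp: y_def m_def coeff_poly_cutoff)
  qed
  then have "z = nat_eval \<alpha> y + real m * \<alpha> ^ (n - 1)"
    using f(2) by (metis nat_eval_add nat_eval_monom)
  then have "\<alpha> * z = \<alpha> * nat_eval \<alpha> y + real m * (\<alpha> * \<alpha> ^ (n - 1))"
    by (simp add: algebra_simps)
  then have "\<alpha> * z = \<alpha> * nat_eval \<alpha> y + real m * nat_eval \<alpha> c"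
    by (simp only: gen_times_top_power)
  then have "nat_eval \<alpha> x = nat_eval \<alpha> (pCons 0 y + smult m c)"
    using x(2) by (simp add: nat_eval_add nat_eval_smult)
  moreover have "degree (pCons 0 y + smult m c) < n"
  proof (rule degree_less_if_support_below[OF n_pos])
    fix i assume "coeff (pCons 0 y + smult m c) i \<noteq> 0"
    then show "i < n" using le_degree[of c i] degree_c
      by (cases i) (auto simp: y_def coeff_poly_cutoff split: if_splits)
  qed
  ultimately show ?thesis using unique x(1) that by blast
qed

lemma gen_prime:
  assumes "factorial_monoid (multiplicative_monoid (nat_adjoin \<alpha>))"
    "nat_eval \<alpha> f * nat_eval \<alpha> g = \<alpha> * z" "z \<in> nat_adjoin \<alpha>" "degree f < n" "degree g < n"
  obtains m y where "f = pCons 0 y + smult m c \<or> g = pCons 0 y + smult m c"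
proof -
  obtain w where "w \<in> nat_adjoin \<alpha>" "nat_eval \<alpha> f = \<alpha> * w \<or> nat_eval \<alpha> g = \<alpha> * w"
    using multiplicative_atom_prime[OF assms(1) nonzero_ge_1 gen_in_nat_adjoin gen_gt_1 gen_is_atom
        nat_eval_in_nat_adjoin nat_eval_in_nat_adjoin assms(3,2)] by blast
  then have "\<exists>m y. f = pCons 0 y + smult m c \<or> g = pCons 0 y + smult m c"
    using gen_multiple_coords[OF assms(4)] gen_multiple_coords[OF assms(5)] by metis
  then show ?thesis using that by blast
qed

text \<open>
  Two products of elements that are not divisible by \<open>\<alpha>\<close> rule out \<open>d \<noteq> 0\<close>, where \<open>c(x) = b + x d(x)\<close>. If \<open>b = 1\<close>, then
  \<open>(2 + \<alpha> d(\<alpha>))\<^sup>2 = 4 \<alpha>\<^sup>n + \<alpha>\<^sup>2 d(\<alpha>)\<^sup>2\<close>. If \<open>b \<ge> 2\<close>, then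
  \<open>b (1 + \<alpha> d(\<alpha>)) = \<alpha>\<^sup>n + (b - 1) \<alpha> d(\<alpha>)\<close>. Both right-hand sides are divisible by \<open>\<alpha>\<close>.
  Finally, \<open>d = 0\<close> and \<open>b = 1\<close> would give \<open>\<alpha>\<^sup>n = 1\<close>.
\<close>

lemma factorial_imp_pure_power:
  assumes fac: "factorial_monoid (multiplicative_monoid (nat_adjoin \<alpha>))"
  shows "\<exists>b\<ge>2. c = [:b:]"
proof -
  obtain b d where c: "c = pCons b d" by (metis pCons_cases)
  have b: "b > 0" using const_coeff_pos by (simp add: c)
  have power: "\<alpha> ^ n = b + \<alpha> * nat_eval \<alpha> d" using power_n by (simp add: c)
  have power': "\<alpha> ^ n = \<alpha> * \<alpha> ^ (n - 1)" using gen_times_top_power power_n by simp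
  have deg: "degree (pCons e d) < n" for e
    using degree_c n_pos by (cases "d = 0") (auto simp: c)
  \<comment> \<open>In each case the constant term determines \<open>m\<close>, or excludes every \<open>m\<close>; the other coordinates then
      force \<open>d = 0\<close>.\<close>
  have "d = 0"
  proof (cases "b = 1")
    case True
    have "nat_eval \<alpha> (pCons 2 d) * nat_eval \<alpha> (pCons 2 d)
        = 4 * \<alpha> ^ n + \<alpha> * (\<alpha> * (nat_eval \<alpha> d * nat_eval \<alpha> d))"
      using power True by (simp add: algebra_simps)
    also have "\<dots> = \<alpha> * nat_eval \<alpha> (monom 4 (n - 1) + pCons 0 (d * d))"
      by (simp add: power' nat_eval_add nat_eval_mult nat_eval_monom algebra_simps)
    finally obtain m y where *: "pCons 2 d = pCons 0 y + smult m c"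
      using gen_prime[OF fac] deg by (metis nat_eval_in_nat_adjoin)
    then have "m = 2" "d = y + smult m d" using True by (auto simp: c)
    show ?thesis
    proof (rule poly_eqI)
      fix i
      have "coeff d i = coeff y i + 2 * coeff d i"
        using \<open>m = 2\<close> arg_cong[OF \<open>d = _\<close>, of "\<lambda>p. coeff p i"] by simp
      then show "coeff d i = coeff 0 i" by simp
    qed
  next
    case False
    then have b2: "b \<ge> 2" using b by simp
    have "nat_eval \<alpha> [:b:] * nat_eval \<alpha> (pCons 1 d) = \<alpha> ^ n + real (b - 1) * (\<alpha> * nat_eval \<alpha> d)"
      using power b by (simp add: algebra_simps of_nat_diff)
    also have "\<dots> = \<alpha> * nat_eval \<alpha> (monom 1 (n - 1) + smult (b - 1) d)"
      by (simp add: power' nat_eval_add nat_eval_smult nat_eval_monom algebra_simps)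
    finally obtain m y where "[:b:] = pCons 0 y + smult m c \<or> pCons 1 d = pCons 0 y + smult m c"
      using gen_prime[OF fac] deg n_pos by (metis nat_eval_in_nat_adjoin degree_pCons_0)
    then show ?thesis
    proof
      assume "[:b:] = pCons 0 y + smult m c"
      then have "m = 1" "y + smult m d = 0" using b by (auto simp: c)
      show ?thesis
      proof (rule poly_eqI)
        fix i
        have "coeff y i + coeff d i = 0"
          using \<open>m = 1\<close> arg_cong[OF \<open>_ = 0\<close>, of "\<lambda>p. coeff p i"] by simp
        then show "coeff d i = coeff 0 i" by simp
      qed
    next
      assume "pCons 1 d = pCons 0 y + smult m c"
      then have "m * b = 1" by (simp add: c)
      then show ?thesis using b2 by simp
    qed
  qed
  moreover have "b \<noteq> 1"
    using \<open>d = 0\<close> power one_less_power[OF gen_gt_1 n_pos] by auto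
  ultimately show ?thesis using b c by auto
qed

text \<open>
  A power of \<open>\<alpha>\<close> with exponent at least \<open>n\<close> is a multiple of \<open>\<alpha>\<^sup>n = b\<close> and contributes a coordinate of
  at least \<open>b\<close>. So an element whose coordinates are all smaller than \<open>b\<close> is the value of no other
  polynomial, and equations about it can be read as polynomial identities.
\<close>

lemma small_coords_rigid:
  assumes c: "c = [:b:]" "b \<ge> 2"
    and r: "degree r < n" "\<And>i. coeff r i < b"
    and eq: "nat_eval \<alpha> f = nat_eval \<alpha> r"
  shows "f = r"
proof -
  have "degree f < n"
  proof (rule degree_less_if_support_below[OF n_pos], rule ccontr)
    fix k assume k: "coeff f k \<noteq> 0" "\<not> k < n"
    define g where "g = f - monom 1 k"
    have f: "f = monom 1 k + g"
      using k by (intro poly_eqI) (auto simp: g_def coeff_diff)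
    obtain u where u: "degree u < n" "nat_eval \<alpha> u = \<alpha> ^ (k - n)"
      using reduce[OF power_in_nat_adjoin] by blast
    obtain v where v: "degree v < n" "nat_eval \<alpha> v = nat_eval \<alpha> g"
      using reduce[OF nat_eval_in_nat_adjoin] by blast
    have "\<alpha> ^ k = \<alpha> ^ n * \<alpha> ^ (k - n)" using k(2) by (simp flip: power_add)
    also have "\<dots> = real b * nat_eval \<alpha> u" using power_n c u by simp
    finally have "nat_eval \<alpha> (smult b u + v) = nat_eval \<alpha> r"
      using eq f v by (simp add: nat_eval_add nat_eval_smult nat_eval_monom)
    moreover have "degree (smult b u + v) < n"
      using u v by (intro degree_add_less) (auto intro: le_less_trans[OF degree_smult_le])
    ultimately have "r = smult b u + v" using unique r(1) by metis
    moreover have "u \<noteq> 0" using u pos by auto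
    then have "b * 1 \<le> b * lead_coeff u" by (intro mult_le_mono2) (simp add: Suc_le_eq flip: neq0_conv)
    then have "coeff (smult b u + v) (degree u) \<ge> b" by (simp only: coeff_add coeff_smult)
    ultimately show False using r(2)[of "degree u"] by simp
  qed
  then show ?thesis using unique r(1) eq by blast
qed

text \<open>
  If \<open>1 + \<alpha>\<close> were prime, it would divide \<open>1 + \<alpha> + \<alpha>\<^sup>2\<close> or \<open>1 + \<alpha>\<^sup>3\<close>. The quotient in the second case is
  \<open>1 - \<alpha> + \<alpha>\<^sup>2\<close>, whose coordinate at \<open>\<alpha>\<close> is negative. The first case contradicts
  \<open>small_coords_rigid\<close> if \<open>n > 2\<close>; for \<open>n = 2\<close>, where \<open>\<alpha>\<^sup>2 = b\<close> makes the constant coordinate \<open>1 + b\<close> too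
  large for that argument, the coordinates of a quotient are compared directly.
\<close>

lemma pure_power_not_factorial:
  assumes c: "c = [:b:]" "b \<ge> 2"
  shows "\<not> factorial_monoid (multiplicative_monoid (nat_adjoin \<alpha>))"
proof
  assume fac: "factorial_monoid (multiplicative_monoid (nat_adjoin \<alpha>))"
  let ?S = "nat_adjoin \<alpha>"
  note small = small_coords_rigid[OF c]
  have atom: "x = 1 \<or> y = 1" if xy: "x \<in> ?S" "y \<in> ?S" "x * y = 1 + \<alpha>" for x y
  proof -
    obtain f g where fg: "x = nat_eval \<alpha> f" "y = nat_eval \<alpha> g"
      using xy by (auto simp: nat_adjoin_eq_range)
    have "f * g = [:1, 1:]"
      using xy fg c(2) n_ge_2
      by (intro small) (auto simp: nat_eval_mult coeff_pCons split: nat.splits)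
    then have "f = 1 \<or> g = 1" by (rule factor_of_monic_linear)
    then show ?thesis by (auto simp: fg)
  qed
  have identity: "(1 + \<alpha> + \<alpha>\<^sup>2) * (1 + \<alpha> ^ 3) = (1 + \<alpha>) * (1 + \<alpha>\<^sup>2 + \<alpha> ^ 4)"
    by (simp add: algebra_simps power2_eq_square power3_eq_cube power4_eq_xxxx)
  have mem: "1 + \<alpha> \<in> ?S" "1 + \<alpha> + \<alpha>\<^sup>2 \<in> ?S" "1 + \<alpha> ^ 3 \<in> ?S" "1 + \<alpha>\<^sup>2 + \<alpha> ^ 4 \<in> ?S"
    by (intro nat_adjoin_add one_in_nat_adjoin gen_in_nat_adjoin power_in_nat_adjoin)+
  have "\<exists>w\<in>?S. 1 + \<alpha> + \<alpha>\<^sup>2 = (1 + \<alpha>) * w \<or> 1 + \<alpha> ^ 3 = (1 + \<alpha>) * w"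
    using pos by (intro multiplicative_atom_prime[OF fac nonzero_ge_1 mem(1) _ atom mem(2-4) identity])
      simp_all
  then obtain w where w: "w \<in> ?S"
    "1 + \<alpha> + \<alpha>\<^sup>2 = (1 + \<alpha>) * w \<or> 1 + \<alpha> ^ 3 = (1 + \<alpha>) * w" by blast
  obtain f where f: "degree f < n" "nat_eval \<alpha> f = w" using reduce[OF w(1)] by blast
  from w(2) show False
  proof
    assume eq: "1 + \<alpha> + \<alpha>\<^sup>2 = (1 + \<alpha>) * w"
    show False
    proof (cases "n = 2")
      case True
      define p q where "p = coeff f 0" and "q = coeff f 1"
      have pq: "f = [:p, q:]"
      proof (rule poly_eqI)
        fix i show "coeff f i = coeff [:p, q:] i"
          using coeff_eq_0[of f i] f(1) True
          by (auto simp: p_def q_def coeff_pCons split: nat.splits)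
      qed
      have sq: "\<alpha> * \<alpha> = real b" using power_n True c by (simp add: power2_eq_square)
      have "(1 + \<alpha>) * w = real p + q * (\<alpha> * \<alpha>) + (p + q) * \<alpha>"
        using f(2) by (auto simp: pq algebra_simps)
      then have "nat_eval \<alpha> [:1 + b, 1:] = nat_eval \<alpha> [:p + q * b, p + q:]"
        using eq sq by (simp add: power2_eq_square algebra_simps)
      then have "[:1 + b, 1:] = [:p + q * b, p + q:]"
        using n_ge_2 by (intro unique) auto
      then have e: "1 + b = p + q * b" "p + q = 1" by simp_all
      then have "q = 0 \<or> q = 1" by auto
      then show False using e c(2) by auto
    next
      case False
      then have "n > 2" using n_ge_2 by simp
      have "[:1, 1:] * f = [:1, 1, 1:]"
        using \<open>n > 2\<close> c(2) eq f(2)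
        by (intro small) (auto simp: nat_eval_mult nat_eval_add nat_eval_smult coeff_pCons power2_eq_square
            algebra_simps split: nat.splits)
      \<comment> \<open>The quotient would begin with \<open>1 + x\<^sup>2\<close>, and its cubic coefficient would be negative.\<close>
      moreover have "[:1, 1:] * f = f + pCons 0 f"
        by (simp only: mult_pCons_left smult_1_left mult_zero_left pCons_0_0 add_0_right)
      ultimately have cf: "coeff (f + pCons 0 f) i = coeff [:1, 1, 1:] i" for i by metis
      show False using cf[of 0] cf[of 1] cf[of 2] cf[of 3]
        by (simp add: coeff_pCons numeral_2_eq_2 numeral_3_eq_3)
    qed
  next
    assume "1 + \<alpha> ^ 3 = (1 + \<alpha>) * w"
    moreover have "1 + \<alpha> ^ 3 = (1 + \<alpha>) * (1 + \<alpha>\<^sup>2 - \<alpha>)"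
      by (simp add: algebra_simps power2_eq_square power3_eq_cube)
    ultimately have "(1 + \<alpha>) * w = (1 + \<alpha>) * (1 + \<alpha>\<^sup>2 - \<alpha>)" by metis
    then have eq: "w + \<alpha> = 1 + \<alpha>\<^sup>2" using pos by auto
    \<comment> \<open>The coordinates of \<open>1 + \<alpha>\<^sup>2\<close>, which for \<open>n = 2\<close> is the integer \<open>1 + b\<close>.\<close>
    define r where "r = (if n = 2 then [:1 + b:] else [:1, 0, 1:])"
    have "nat_eval \<alpha> (f + [:0, 1:]) = nat_eval \<alpha> r"
      using eq f(2) power_n c by (auto simp: r_def nat_eval_add power2_eq_square)
    moreover have "degree (f + [:0, 1:]) < n" using f(1) n_ge_2 by (intro degree_add_less) auto
    moreover have "degree r < n" using n_ge_2 by (auto simp: r_def)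
    ultimately have "f + [:0, 1:] = r" using unique by blast
    then have "coeff f 1 + 1 = coeff r 1" by auto
    then show False by (auto simp: r_def split: if_splits)
  qed
qed

end

section \<open>The natural numbers\<close>

lemma nat_adjoin_of_nat: "nat_adjoin (real m) = \<nat>"
proof
  show "nat_adjoin (real m) \<subseteq> \<nat>"
    by (auto simp: nat_adjoin_eq_range nat_eval_altdef simp flip: of_nat_power of_nat_mult of_nat_sum)
  show "\<nat> \<subseteq> nat_adjoin (real m)"
    by (auto simp: Nats_def of_nat_in_nat_adjoin)
qed

text \<open>Divisibility is the order of the natural numbers, and the only atom is \<open>1\<close>.\<close>

lemma factorial_additive_Nats: "factorial_monoid (additive_monoid \<nat>)"
proof -
  let ?M = "additive_monoid \<nat>"
  have "comm_monoid ?M"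
    by (rule comm_monoidI) (auto simp: additive_monoid_def)
  then interpret comm_monoid_cancel ?M
    by (rule comm_monoid_cancelI) (auto simp: additive_monoid_def)
  have carr: "carrier ?M = range real"
    by (simp add: additive_monoid_def Nats_def)
  have div: "factor ?M (real m) (real n) \<longleftrightarrow> m \<le> n" for m n
    by (auto simp: factor_def additive_monoid_def Nats_def le_iff_add simp flip: of_nat_add)
  have units: "Units ?M = {0}"
    by (rule Units_additive_monoid) (auto simp: Nats_def)
  have "wf {(x, y). x \<in> carrier ?M \<and> y \<in> carrier ?M \<and> properfactor ?M x y}"
    by (rule wf_subset[OF wf_measure[of "\<lambda>x. nat \<lfloor>x\<rfloor>"]])
      (auto simp: properfactor_def carr div)
  then have "divisor_chain_condition_monoid ?M"
    by unfold_locales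
  moreover have "primeness_condition_monoid ?M"
  proof
    fix a assume a: "a \<in> carrier ?M" "Divisibility.irreducible ?M a"
    obtain n where n: "a = real n" using a(1) by (auto simp: additive_monoid_def Nats_def)
    have at: "a \<noteq> 0" "\<And>x y. x \<in> \<nat> \<Longrightarrow> y \<in> \<nat> \<Longrightarrow> a = x + y \<Longrightarrow> x = 0 \<or> y = 0"
      using irreducible_iff_atom[OF a(1)] a(2) units by (auto simp: additive_monoid_def)
    have "n = 1"
    proof (rule ccontr)
      assume "n \<noteq> 1"
      then show False using at(1) at(2)[of 1 "real (n - 1)"] n by (auto simp: of_nat_diff)
    qed
    show "Divisibility.prime ?M a"
    proof (rule Divisibility.primeI)
      show "a \<notin> Units ?M" using at units by simp
      fix x y assume "x \<in> carrier ?M" "y \<in> carrier ?M"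
        and d: "factor ?M a (x \<otimes>\<^bsub>?M\<^esub> y)"
      then obtain i j where ij: "x = real i" "y = real j"
        by (auto simp: additive_monoid_def Nats_def)
      have "x \<otimes>\<^bsub>?M\<^esub> y = real (i + j)" by (simp add: ij additive_monoid_def)
      then show "factor ?M a x \<or> factor ?M a y"
        using d div[of 1] unfolding n \<open>n = 1\<close> ij by (simp only:) linarith
    qed
  qed
  ultimately show ?thesis using factorial_condition_one by blast
qed

text \<open>
  Divisibility of positive integers is the same among reals as among naturals, so irreducible
  elements are prime because the naturals have greatest common divisors.
\<close>

lemma factorial_multiplicative_Nats: "factorial_monoid (multiplicative_monoid \<nat>)"
proof -
  let ?M = "multiplicative_monoid \<nat>"
  have "comm_monoid ?M"
    by (rule comm_monoidI) (auto simp: multiplicative_monoid_def)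
  then interpret comm_monoid_cancel ?M
    by (rule comm_monoid_cancelI) (auto simp: multiplicative_monoid_def)
  have carr: "carrier ?M = real ` {0<..}"
    by (auto simp: multiplicative_monoid_def Nats_def image_iff)
  have mult: "real m \<otimes>\<^bsub>?M\<^esub> real n = real (m * n)" for m n
    by (simp add: multiplicative_monoid_def)
  have div: "factor ?M (real m) (real n) \<longleftrightarrow> m dvd n" if "n > 0" for m n
    using that by (auto simp: factor_def carr mult dvd_def simp del: of_nat_mult)
  have units: "Units ?M = {1}"
  proof -
    have "\<one>\<^bsub>?M\<^esub> = real 1" by (simp add: multiplicative_monoid_def)
    then have "x = 1" if "x \<in> Units ?M" for x
      using that by (auto simp: Units_def carr mult simp del: of_nat_mult)
    then show ?thesis using Units_one_closed by (auto simp: multiplicative_monoid_def)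
  qed
  have dvd_smaller: "i < j" if "i dvd j" "\<not> j dvd i" "j > 0" for i j :: nat
    using that by (metis dvd_imp_le dvd_refl nat_less_le)
  have "wf {(x, y). x \<in> carrier ?M \<and> y \<in> carrier ?M \<and> properfactor ?M x y}"
    by (rule wf_subset[OF wf_measure[of "\<lambda>x. nat \<lfloor>x\<rfloor>"]])
      (auto simp: properfactor_def carr div dvd_smaller)
  then have "divisor_chain_condition_monoid ?M"
    by unfold_locales
  moreover have "primeness_condition_monoid ?M"
  proof
    fix a assume a: "a \<in> carrier ?M" "Divisibility.irreducible ?M a"
    obtain n where n: "a = real n" "n > 0" using a(1) by (auto simp: carr)
    have at: "a \<noteq> 1" "\<And>x y. x \<in> carrier ?M \<Longrightarrow> y \<in> carrier ?M \<Longrightarrow> a = x \<otimes>\<^bsub>?M\<^esub> y \<Longrightarrow> x = 1 \<or> y = 1"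
      using irreducible_iff_atom[OF a(1)] a(2) units by auto
    have "Factorial_Ring.irreducible n"
    proof (rule Factorial_Ring.irreducibleI)
      show "n \<noteq> 0" "\<not> n dvd 1" using n at(1) by auto
      fix i j assume "n = i * j"
      then show "i dvd 1 \<or> j dvd 1"
        using n at(2)[of "real i" "real j"] by (auto simp: carr mult)
    qed
    then have p: "prime_elem n" by (rule irreducible_imp_prime_elem_gcd)
    show "Divisibility.prime ?M a"
    proof (rule Divisibility.primeI)
      show "a \<notin> Units ?M" using at units by simp
      fix x y assume "x \<in> carrier ?M" "y \<in> carrier ?M"
        and d: "factor ?M a (x \<otimes>\<^bsub>?M\<^esub> y)"
      then obtain i j where ij: "x = real i" "y = real j" "i > 0" "j > 0"
        by (auto simp: carr)
      then show "factor ?M a x \<or> factor ?M a y"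
        using d p by (auto simp: n(1) mult div prime_elem_dvd_mult_iff simp del: of_nat_mult)
    qed
  qed
  ultimately show ?thesis using factorial_condition_one by blast
qed

theorem theorem4p8:
  fixes \<alpha> :: real
  assumes "\<alpha> > 0" and "algebraic \<alpha>"
  shows "bi_UFS (nat_adjoin \<alpha>) \<longleftrightarrow> \<alpha> \<in> \<nat> - {0}"
proof
  assume "bi_UFS (nat_adjoin \<alpha>)"
  then have fac: "factorial_monoid (additive_monoid (nat_adjoin \<alpha>))"
    "factorial_monoid (multiplicative_monoid (nat_adjoin \<alpha>))"
    by (auto simp: bi_UFS_def)
  show "\<alpha> \<in> \<nat> - {0}"
  proof (cases "\<alpha> = 1")
    case False
    then obtain n c where "power_basis \<alpha> n c"
      using factorial_additive_imp_power_basis assms fac(1) by blast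
    then interpret power_basis \<alpha> n c .
    have "\<not> n \<ge> 2"
    proof
      assume "n \<ge> 2"
      then interpret irrational_power_basis \<alpha> n c by unfold_locales
      show False
        using factorial_imp_pure_power pure_power_not_factorial fac(2) by blast
    qed
    then have "n = 1" using n_pos by simp
    then have "degree c = 0" using degree_c by simp
    then obtain m where "c = [:m:]" using degree_eq_zeroE by blast
    then show ?thesis using power_n \<open>n = 1\<close> assms(1) by auto
  qed simp
next
  assume "\<alpha> \<in> \<nat> - {0}"
  then obtain m where "\<alpha> = real m" by (auto simp: Nats_def)
  then show "bi_UFS (nat_adjoin \<alpha>)"
    using positive_semidomain_nat_adjoin[OF assms(1)] factorial_additive_Nats
      factorial_multiplicative_Nats
    by (simp add: bi_UFS_def nat_adjoin_of_nat)
qed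

end
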